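(* Let $(C,\phi)$ be a semicoherent system with $C=\{1,\ldots,n\}$ and with continuous and exchangeable component lifetimes $T_1,\ldots,T_n$, let $h$ be its reliability function, let $M\subseteq C$ be nonempty and let $m=|M|$. Let $h(x,z)$ be the bivariate polynomial obtained from $h(\mathbf{x})$ by replacing every variable $x_i$ with $i\in M$ by $x$ and every variable $x_i$ with $i\in C\setminus M$ by $z$. Let $g(x,z)=\partial_x h(x,z)$. For every $k\in\{1,\ldots,m\}$, let $c_{k-1}(z)$ be the coefficient of $x^{k-1}$ in the polynomial $(R_1^{m-1}g)(x+1,z)=(x+1)^{m-1}\,g\big(\frac{1}{x+1},z\big)$. Then the $M$-signature $\mathbf{s}_M=(s_M^{(1)},\ldots,s_M^{(m)})$ of the system is given by $$s_M^{(k)}=\int_0^1 t^{m-k}(1-t)^{k-1}\,c_{k-1}(t)\,dt,\qquad k=1,\ldots,m.$$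
   Context: System: $C=\{1,\ldots,n\}$ is the set of components and $\phi\colon\{0,1\}^n\to\{0,1\}$ is the structure function, giving the state of the system from the states of the components. Semicoherent means that $\phi$ is nondecreasing in each variable, $\phi(0,\ldots,0)=0$ and $\phi(1,\ldots,1)=1$. Boolean vectors $\mathbf{x}\in\{0,1\}^n$ are identified with subsets $A\subseteq C$ via $x_i=1$ iff $i\in A$, so $\phi(A)$ makes sense. Lifetimes: $T_1,\ldots,T_n$ are nonnegative random variables on a common probability space, exchangeable (their joint distribution is invariant under permutations of the indices) and continuous, in the sense that there are no ties almost surely: $\Pr(T_i=T_j)=0$ for $i\neq j$. The system lifetime is $T_S=\max_{A\subseteq C,\ \phi(A)=1}\ \min_{i\in A}T_i$ (the system works at time $t$ iff $\phi$ equals $1$ at the vector of component states at time $t$). $M$-signature: for nonempty $M\subseteq C$ with $m=|M|$, it is the $m$-tuple with $s_M^{(k)}=\Pr(T_S=T_{k:M})$, $k\in\{1,\ldots,m\}$, where $T_{k:M}$ is the $k$-th smallest of the variables $T_i$, $i\in M$. Reliability function: the multilinear polynomial $h(\mathbf{x})=h(x_1,\ldots,x_n)=\sum_{A\subseteq C}\phi(A)\prod_{i\in A}x_i\prod_{i\in C\setminus A}(1-x_i)$. Reflection: for a polynomial $f(x)=a_px^p+\cdots+a_1x+a_0$ of degree at most $p$, the $p$-reflected polynomial is $(R^pf)(x)=a_0x^p+a_1x^{p-1}+\cdots+a_p$, i.e. $(R^pf)(x)=x^pf(1/x)$. $R_1^{m-1}g$ is the $(m-1)$-reflected of $g$ with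 respect to its first argument ($g(x,z)$ has degree at most $m-1$ in $x$). *)

theory Defs
  imports "HOL-Probability.Probability" "HOL-Computational_Algebra.Polynomial"
begin

text \<open>A Boolean vector is represented by the set of the indices at which it is 1, so that a
  structure function is a predicate on the subsets of \<open>{1..n}\<close>; its values on other sets of
  natural numbers are irrelevant.\<close>

definition semicoherent :: "nat \<Rightarrow> (nat set \<Rightarrow> bool) \<Rightarrow> bool" where
  "semicoherent n \<phi> \<longleftrightarrow>
     (\<forall>A B. A \<subseteq> B \<and> B \<subseteq> {1..n} \<longrightarrow> \<phi> A \<longrightarrow> \<phi> B) \<and> \<not> \<phi> {} \<and> \<phi> {1..n}"

definition exchangeable :: "'a measure \<Rightarrow> nat \<Rightarrow> (nat \<Rightarrow> 'a \<Rightarrow> real) \<Rightarrow> bool" where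
  "exchangeable P n T \<longleftrightarrow>
     (\<forall>\<pi>. \<pi> permutes {1..n} \<longrightarrow>
        distr P (\<Pi>\<^sub>M i\<in>{1..n}. borel) (\<lambda>\<omega>. \<lambda>i\<in>{1..n}. T (\<pi> i) \<omega>) =
        distr P (\<Pi>\<^sub>M i\<in>{1..n}. borel) (\<lambda>\<omega>. \<lambda>i\<in>{1..n}. T i \<omega>))"

definition no_ties :: "'a measure \<Rightarrow> nat \<Rightarrow> (nat \<Rightarrow> 'a \<Rightarrow> real) \<Rightarrow> bool" where
  "no_ties P n T \<longleftrightarrow>
     (\<forall>i\<in>{1..n}. \<forall>j\<in>{1..n}. i \<noteq> j \<longrightarrow> measure P {\<omega> \<in> space P. T i \<omega> = T j \<omega>} = 0)"

definition system_lifetime ::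
  "nat \<Rightarrow> (nat set \<Rightarrow> bool) \<Rightarrow> (nat \<Rightarrow> 'a \<Rightarrow> real) \<Rightarrow> 'a \<Rightarrow> real" where
  "system_lifetime n \<phi> T \<omega> = Max ((\<lambda>A. Min ((\<lambda>i. T i \<omega>) ` A)) ` {A. A \<subseteq> {1..n} \<and> \<phi> A})"

text \<open>The \<open>k\<close>-th smallest (\<open>1 \<le> k \<le> card M\<close>), counted with multiplicity, of the
  values \<open>T i \<omega>\<close> for \<open>i \<in> M\<close>.\<close>

definition order_stat :: "(nat \<Rightarrow> 'a \<Rightarrow> real) \<Rightarrow> nat set \<Rightarrow> nat \<Rightarrow> 'a \<Rightarrow> real" where
  "order_stat T M k \<omega> = sort (map (\<lambda>i. T i \<omega>) (sorted_list_of_set M)) ! (k - 1)"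

definition M_signature ::
  "'a measure \<Rightarrow> nat \<Rightarrow> (nat set \<Rightarrow> bool) \<Rightarrow> (nat \<Rightarrow> 'a \<Rightarrow> real) \<Rightarrow> nat set \<Rightarrow> nat \<Rightarrow> real"
where
  "M_signature P n \<phi> T M k =
     measure P {\<omega> \<in> space P. system_lifetime n \<phi> T \<omega> = order_stat T M k \<omega>}"

text \<open>The reliability polynomial is multivariate; it is given by its values in arbitrary
  commutative rings, so that polynomials can be substituted for its variables.\<close>

definition reliability ::
  "nat \<Rightarrow> (nat set \<Rightarrow> bool) \<Rightarrow> (nat \<Rightarrow> 'b::comm_ring_1) \<Rightarrow> 'b" where
  "reliability n \<phi> x =
     (\<Sum>A\<in>Pow {1..n}. of_bool (\<phi> A) * (\<Prod>i\<in>A. x i) * (\<Prod>i\<in>{1..n} - A. 1 - x i))"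

text \<open>A polynomial in \<open>x\<close> and \<open>z\<close> is a polynomial in \<open>x\<close> whose coefficients are
  polynomials in \<open>z\<close>. In particular \<^const>\<open>pderiv\<close> is the derivative with respect to
  \<open>x\<close>.\<close>

definition reliability_xz :: "nat \<Rightarrow> (nat set \<Rightarrow> bool) \<Rightarrow> nat set \<Rightarrow> real poly poly" where
  "reliability_xz n \<phi> M = reliability n \<phi> (\<lambda>i. if i \<in> M then [:0, 1:] else [:[:0, 1:]:])"

lemma poly_reliability_xz:
  "poly (poly (reliability_xz n \<phi> M) [:x:]) z =
     reliability n \<phi> (\<lambda>i. if i \<in> M then x else z)"
  unfolding reliability_xz_def reliability_def poly_sum poly_mult poly_prod
  by (intro sum.cong arg_cong2[where f = "(*)"] prod.cong) auto

text \<open>Unlike \<^const>\<open>reflect_poly\<close>, the reflection is relative to a degree bound \<open>p\<close>, not to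
  the actual degree.\<close>

definition reflected :: "nat \<Rightarrow> 'b::comm_ring_1 poly \<Rightarrow> 'b poly" where
  "reflected p f = (\<Sum>j\<le>p. monom (coeff f j) (p - j))"

lemma poly_reflected:
  fixes f :: "'b::field poly"
  assumes "degree f \<le> p" and "x \<noteq> 0"
  shows "poly (reflected p f) x = x ^ p * poly f (1 / x)"
proof -
  have "poly f (1 / x) = (\<Sum>j\<le>p. coeff f j * (1 / x) ^ j)"
    unfolding poly_altdef using assms(1)
    by (intro sum.mono_neutral_left) (auto simp: coeff_eq_0)
  then show ?thesis
    using assms(2)
    by (auto simp: reflected_def poly_sum poly_monom sum_distrib_left power_diff
        power_one_over intro!: sum.cong)
qed

text \<open>\<open>signature_coeff n \<phi> M j\<close> is the coefficient of \<open>x ^ j\<close>, a polynomial in \<open>z\<close>.\<close>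

definition signature_coeff :: "nat \<Rightarrow> (nat set \<Rightarrow> bool) \<Rightarrow> nat set \<Rightarrow> nat \<Rightarrow> real poly" where
  "signature_coeff n \<phi> M j =
     coeff (pcompose (reflected (card M - 1) (pderiv (reliability_xz n \<phi> M))) [:1, 1:]) j"

end

theory Submission
  imports Defs
begin

text \<open>
  The proof expands both sides over the same pairs \<open>(j, B)\<close>, where \<open>j \<in> M\<close> is pivotal at
  \<open>B \<subseteq> {1..n} - {j}\<close>, that is, \<open>\<phi> (insert j B)\<close> holds and \<open>\<phi> B\<close> fails, and where
  \<open>card (B \<inter> M) = card M - k\<close>.

  On the probabilistic side, almost surely there are no ties. Then the system lifetime is the
  \<open>k\<close>-th smallest lifetime in \<open>M\<close> exactly if, for one of these pairs, \<open>B\<close> is the set of the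
  components that outlive \<open>j\<close> (\<open>lifetime_eq_order_stat_iff\<close>). Exchangeability makes the
  probability of the latter event depend only on \<open>b = card B\<close>, and a count shows that it is
  \<open>b! (n - 1 - b)! / n!\<close> (\<open>prob_survivors\<close>), which is the integral of
  \<open>t ^ b * (1 - t) ^ (n - 1 - b)\<close> over the unit interval.

  On the algebraic side, differentiating \<open>h(x, z)\<close> with respect to \<open>x\<close> yields a sum over all
  pivotal pairs of Bernstein polynomials in \<open>x\<close> times Bernstein polynomials in \<open>z\<close>
  (\<open>pderiv_reliability\<close>). Reflection followed by the shift turns the former into powers of \<open>x\<close>
  (\<open>shifted_reflected_Bernstein\<close>), so that the coefficient of \<open>x ^ (k - 1)\<close> selects the pairs
  with \<open>card (B \<inter> M) = card M - k\<close> (\<open>signature_coeff_eq\<close>). Multiplying by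
  \<open>t ^ (card M - k) * (1 - t) ^ (k - 1)\<close> restores the contribution of the components in \<open>M\<close>,
  and the integrand becomes the sum of the \<open>t ^ b * (1 - t) ^ (n - 1 - b)\<close>.
\<close>

section \<open>Lifetimes without ties\<close>

text \<open>Comparing an entry of a sorted list with a threshold amounts to counting. Stating this for an
  arbitrary downward closed property treats \<open>\<le> t\<close> and \<open>< t\<close> at once. Repeated entries
  are covered because measurability of the order statistics concerns all outcomes, including
  those with ties.\<close>

lemma nth_sort_iff:
  fixes xs :: "'b::linorder list"
  assumes down: "\<And>a b. a \<le> b \<Longrightarrow> Q b \<Longrightarrow> Q a" and k: "k < length xs"
  shows "Q (sort xs ! k) \<longleftrightarrow> k < length (filter Q xs)"
proof -
  let ?I = "{i. i < length xs \<and> Q (sort xs ! i)}"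
  have len: "length (filter Q xs) = card ?I"
    using length_filter_conv_card[of Q "sort xs"] by (simp add: filter_sort)
  show ?thesis
  proof
    assume "Q (sort xs ! k)"
    then have "{..k} \<subseteq> ?I"
      using k down sorted_nth_mono[OF sorted_sort[of xs], of _ k] by auto
    from card_mono[OF _ this] show "k < length (filter Q xs)"
      by (simp add: len)
  next
    assume less: "k < length (filter Q xs)"
    show "Q (sort xs ! k)"
    proof (rule ccontr)
      assume "\<not> Q (sort xs ! k)"
      have "i < k" if "i < length xs" "Q (sort xs ! i)" for i
      proof (rule ccontr)
        assume "\<not> i < k"
        then have "sort xs ! k \<le> sort xs ! i"
          using that(1) by (intro sorted_nth_mono) auto
        then show False
          using down that(2) \<open>\<not> Q (sort xs ! k)\<close> by blast
      qed
      then have "?I \<subseteq> {..<k}"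
        by auto
      from card_mono[OF _ this] show False
        using less by (simp add: len)
    qed
  qed
qed

lemma order_stat_iff:
  assumes "finite M" and "k \<in> {1..card M}"
    and "\<And>a b. a \<le> b \<Longrightarrow> Q b \<Longrightarrow> Q a"
  shows "Q (order_stat T M k \<omega>) \<longleftrightarrow> k \<le> card {i \<in> M. Q (T i \<omega>)}"
proof -
  let ?xs = "map (\<lambda>i. T i \<omega>) (sorted_list_of_set M)"
  have "length (filter Q ?xs) = card {i \<in> M. Q (T i \<omega>)}"
    using assms(1) by (auto simp: filter_map distinct_length_filter intro!: arg_cong[where f = card])
  moreover have "Q (order_stat T M k \<omega>) \<longleftrightarrow> k - 1 < length (filter Q ?xs)"
    unfolding order_stat_def by (intro nth_sort_iff) (use assms in auto)
  ultimately show ?thesis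
    using assms(2) by auto
qed

lemma order_stat_attained:
  assumes "finite M" and "k \<in> {1..card M}"
  shows "\<exists>j\<in>M. T j \<omega> = order_stat T M k \<omega>"
proof -
  let ?xs = "map (\<lambda>i. T i \<omega>) (sorted_list_of_set M)"
  have "sort ?xs ! (k - 1) \<in> set (sort ?xs)"
    by (rule nth_mem) (use assms in auto)
  then show ?thesis
    using assms(1) by (auto simp: order_stat_def)
qed

lemma eq_order_stat_iff:
  assumes "finite M" and "k \<in> {1..card M}" and "inj_on (\<lambda>i. T i \<omega>) M" and "j \<in> M"
  shows "T j \<omega> = order_stat T M k \<omega> \<longleftrightarrow> card {i \<in> M. T j \<omega> < T i \<omega>} = card M - k"
proof -
  let ?L = "{i \<in> M. T i \<omega> < T j \<omega>}" and ?G = "{i \<in> M. T j \<omega> < T i \<omega>}"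
  have le: "{i \<in> M. T i \<omega> \<le> T j \<omega>} = insert j ?L"
    using inj_onD[OF assms(3) _ _ assms(4)] assms(4) by (auto simp: order_le_less)
  have "insert j ?L \<union> ?G = M"
    unfolding le[symmetric] by auto
  then have "card M = card (insert j ?L \<union> ?G)"
    by simp
  also have "\<dots> = Suc (card ?L) + card ?G"
    using assms(1) by (subst card_Un_disjoint) auto
  finally have card: "card M = Suc (card ?L) + card ?G" .
  have "order_stat T M k \<omega> \<le> T j \<omega> \<longleftrightarrow> k \<le> card (insert j ?L)"
    unfolding le[symmetric] by (rule order_stat_iff) (use assms in auto)
  moreover have "order_stat T M k \<omega> < T j \<omega> \<longleftrightarrow> k \<le> card ?L"
    by (rule order_stat_iff) (use assms in auto)
  ultimately show ?thesis
    using card assms(1,2) by auto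
qed

lemma ex1_rank:
  fixes T :: "nat \<Rightarrow> 'a \<Rightarrow> real" and \<omega> :: 'a
  assumes "finite M" and "k \<in> {1..card M}" and "inj_on (\<lambda>i. T i \<omega>) M"
  shows "\<exists>!j. j \<in> M \<and> card {i \<in> M. T j \<omega> < T i \<omega>} = card M - k"
proof -
  obtain j where j: "j \<in> M" "T j \<omega> = order_stat T M k \<omega>"
    using order_stat_attained[OF assms(1,2), of T \<omega>] by blast
  have iff: "card {i \<in> M. T j' \<omega> < T i \<omega>} = card M - k \<longleftrightarrow> T j' \<omega> = T j \<omega>"
    if "j' \<in> M" for j'
    using eq_order_stat_iff[of M k T \<omega> j'] assms that j(2) by simp
  show ?thesis
  proof (rule ex1I[of _ j])
    show "j \<in> M \<and> card {i \<in> M. T j \<omega> < T i \<omega>} = card M - k"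
      using j(1) iff[OF j(1)] by simp
    fix j' assume "j' \<in> M \<and> card {i \<in> M. T j' \<omega> < T i \<omega>} = card M - k"
    then show "j' = j"
      using iff[of j'] inj_onD[OF assms(3) _ _ j(1), of j'] by simp
  qed
qed

lemma semicoherent_mono:
  "semicoherent n \<phi> \<Longrightarrow> A \<subseteq> B \<Longrightarrow> B \<subseteq> {1..n} \<Longrightarrow> \<phi> A \<Longrightarrow> \<phi> B"
  by (simp add: semicoherent_def)

text \<open>The counterpart of \<open>order_stat_iff\<close>: the system is alive at a time exactly if \<open>\<phi>\<close> holds at
  the set of the components alive at that time. The upward closed property \<open>Q\<close> is meant to be
  \<open>t \<le>\<close> or \<open>t <\<close>.\<close>

lemma system_lifetime_iff:
  assumes "semicoherent n \<phi>" and up: "\<And>a b. a \<le> b \<Longrightarrow> Q a \<Longrightarrow> Q b"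
  shows "Q (system_lifetime n \<phi> T \<omega>) \<longleftrightarrow> \<phi> {i \<in> {1..n}. Q (T i \<omega>)}"
proof -
  let ?F = "{A. A \<subseteq> {1..n} \<and> \<phi> A}" and ?min = "\<lambda>A. Min ((\<lambda>i. T i \<omega>) ` A)"
  have fin: "finite (?min ` ?F)"
    by simp
  have ne: "A \<noteq> {}" "finite A" if "A \<in> ?F" for A
    using assms(1) that finite_subset[of A "{1..n}"] by (auto simp: semicoherent_def)
  show ?thesis
  proof
    assume Q: "Q (system_lifetime n \<phi> T \<omega>)"
    have "Max (?min ` ?F) \<in> ?min ` ?F"
      using assms(1) by (intro Max_in fin) (auto simp: semicoherent_def)
    then obtain A where A: "A \<in> ?F" "system_lifetime n \<phi> T \<omega> = ?min A"
      by (auto simp: system_lifetime_def)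
    have "?min A \<le> T i \<omega>" if "i \<in> A" for i
      using ne[OF A(1)] that by simp
    then have "A \<subseteq> {i \<in> {1..n}. Q (T i \<omega>)}"
      using A Q up by auto
    then show "\<phi> {i \<in> {1..n}. Q (T i \<omega>)}"
      using semicoherent_mono[OF assms(1), of A] A(1) by blast
  next
    assume "\<phi> {i \<in> {1..n}. Q (T i \<omega>)}"
    then have A: "{i \<in> {1..n}. Q (T i \<omega>)} \<in> ?F" (is "?A \<in> _")
      by auto
    have "?min ?A \<in> (\<lambda>i. T i \<omega>) ` ?A"
      using ne[OF A] by (intro Min_in) auto
    then have "Q (?min ?A)"
      by auto
    moreover have "?min ?A \<le> system_lifetime n \<phi> T \<omega>"
      unfolding system_lifetime_def using A by (intro Max_ge[OF fin]) blast
    ultimately show "Q (system_lifetime n \<phi> T \<omega>)"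
      using up by blast
  qed
qed

lemma system_lifetime_eq_iff:
  assumes "semicoherent n \<phi>" and "inj_on (\<lambda>i. T i \<omega>) {1..n}" and "j \<in> {1..n}"
  shows "system_lifetime n \<phi> T \<omega> = T j \<omega> \<longleftrightarrow>
    \<phi> (insert j {i \<in> {1..n}. T j \<omega> < T i \<omega>}) \<and> \<not> \<phi> {i \<in> {1..n}. T j \<omega> < T i \<omega>}"
proof -
  have le: "insert j {i \<in> {1..n}. T j \<omega> < T i \<omega>} = {i \<in> {1..n}. T j \<omega> \<le> T i \<omega>}"
    using inj_onD[OF assms(2) _ _ assms(3)] assms(3) by (auto simp: order_le_less)
  have "T j \<omega> \<le> system_lifetime n \<phi> T \<omega> \<longleftrightarrow> \<phi> {i \<in> {1..n}. T j \<omega> \<le> T i \<omega>}"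
    and "T j \<omega> < system_lifetime n \<phi> T \<omega> \<longleftrightarrow> \<phi> {i \<in> {1..n}. T j \<omega> < T i \<omega>}"
    by (rule system_lifetime_iff[OF assms(1)]; simp)+
  note this[symmetric]
  moreover have "s = t \<longleftrightarrow> t \<le> s \<and> \<not> t < s" for s t :: real
    by auto
  ultimately show ?thesis
    unfolding le by (simp only:)
qed

text \<open>The pairs \<open>(j, B)\<close> for which \<open>j\<close> is pivotal at \<open>B\<close>: if \<open>B\<close> is the set of the components
  that outlive \<open>j\<close>, the system fails together with \<open>j\<close>. These pairs index the terms both of
  the signature and of the derivative of the reliability polynomial.\<close>

definition pivots :: "nat \<Rightarrow> (nat set \<Rightarrow> bool) \<Rightarrow> nat set \<Rightarrow> (nat \<times> nat set) set" where
  "pivots n \<phi> M = (SIGMA j:M. {B \<in> Pow ({1..n} - {j}). \<phi> (insert j B) \<and> \<not> \<phi> B})"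

lemma finite_pivots: "M \<subseteq> {1..n} \<Longrightarrow> finite (pivots n \<phi> M)"
  unfolding pivots_def by (intro finite_SigmaI) (simp_all add: finite_subset[of M "{1..n}"])

text \<open>In the absence of ties, the system lifetime is \<open>T j\<close> exactly if \<open>j\<close> is pivotal at the set of
  the components that outlive it, and \<open>T j\<close> is the \<open>k\<close>-th smallest lifetime in \<open>M\<close> exactly if
  \<open>card M - k\<close> of these belong to \<open>M\<close>. The conclusion has the form in which
  \<open>prob_space.prob_sum\<close> splits an event into almost surely disjoint pieces.\<close>

lemma lifetime_eq_order_stat_iff:
  fixes T :: "nat \<Rightarrow> 'a \<Rightarrow> real" and \<omega> :: 'a
  assumes "semicoherent n \<phi>" and inj: "inj_on (\<lambda>i. T i \<omega>) {1..n}"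
    and M: "M \<subseteq> {1..n}" and k: "k \<in> {1..card M}"
  defines "I \<equiv> {(j, B) \<in> pivots n \<phi> M. card (B \<inter> M) = card M - k}"
  defines "E \<equiv> \<lambda>(j, B). {i \<in> {1..n}. T j \<omega> < T i \<omega>} = B"
  shows "(\<forall>p\<in>I. E p \<longrightarrow> system_lifetime n \<phi> T \<omega> = order_stat T M k \<omega>) \<and>
    (system_lifetime n \<phi> T \<omega> = order_stat T M k \<omega> \<longrightarrow> (\<exists>!p\<in>I. E p))"
proof -
  have fin: "finite M" and injM: "inj_on (\<lambda>i. T i \<omega>) M"
    using M finite_subset[OF M] inj_on_subset[OF inj M] by auto
  let ?G = "\<lambda>j. {i \<in> {1..n}. T j \<omega> < T i \<omega>}"
  have G: "?G j \<inter> M = {i \<in> M. T j \<omega> < T i \<omega>}" for j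
    using M by auto
  have iff: "(j, B) \<in> I \<and> E (j, B) \<longleftrightarrow> j \<in> M \<and> T j \<omega> = order_stat T M k \<omega> \<and>
      system_lifetime n \<phi> T \<omega> = T j \<omega> \<and> B = ?G j" for j B
  proof (cases "j \<in> M")
    case True
    then have "j \<in> {1..n}"
      using M by blast
    have sub: "?G j \<subseteq> {1..n} - {j}"
      by auto
    have "(j, B) \<in> I \<and> E (j, B) \<longleftrightarrow> B = ?G j \<and> card (?G j \<inter> M) = card M - k \<and>
        \<phi> (insert j (?G j)) \<and> \<not> \<phi> (?G j)"
      unfolding I_def E_def pivots_def using True sub by (simp; blast)
    also have "card (?G j \<inter> M) = card M - k \<longleftrightarrow> T j \<omega> = order_stat T M k \<omega>"
      unfolding G by (rule eq_order_stat_iff[symmetric]) (fact fin k injM True)+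
    also have "\<phi> (insert j (?G j)) \<and> \<not> \<phi> (?G j) \<longleftrightarrow> system_lifetime n \<phi> T \<omega> = T j \<omega>"
      by (rule system_lifetime_eq_iff[symmetric]) (fact assms(1) inj \<open>j \<in> {1..n}\<close>)+
    finally show ?thesis
      using True by blast
  qed (auto simp: I_def pivots_def)
  obtain j where j: "j \<in> M" "T j \<omega> = order_stat T M k \<omega>"
    using order_stat_attained[OF fin k, of T \<omega>] by blast
  show ?thesis
  proof (intro conjI ballI impI)
    fix p assume "p \<in> I" "E p"
    then show "system_lifetime n \<phi> T \<omega> = order_stat T M k \<omega>"
      using iff[of "fst p" "snd p"] by simp
  next
    assume "system_lifetime n \<phi> T \<omega> = order_stat T M k \<omega>"
    then have *: "(j, ?G j) \<in> I \<and> E (j, ?G j)"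
      using iff j by auto
    show "\<exists>!p\<in>I. E p"
    proof (rule ex1I[of _ "(j, ?G j)"])
      fix p assume "p \<in> I \<and> E p"
      then have p: "fst p \<in> M" "T (fst p) \<omega> = T j \<omega>" "snd p = ?G (fst p)"
        using iff[of "fst p" "snd p"] j by auto
      then have "fst p = j"
        using inj_onD[OF injM p(2) p(1) j(1)] by simp
      then show "p = (j, ?G j)"
        using p(3) by (simp add: prod_eq_iff)
    qed (rule *)
  qed
qed

section \<open>The components that outlive a given one\<close>

lemma sets_survivors:
  fixes f :: "nat \<Rightarrow> 'a \<Rightarrow> real"
  assumes f: "\<And>i. i \<in> {1..n} \<Longrightarrow> f i \<in> borel_measurable N" and j: "j \<in> {1..n}"
  shows "{x \<in> space N. {i \<in> {1..n}. f j x < f i x} = B} \<in> sets N"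
proof (cases "B \<subseteq> {1..n}")
  case True
  then have "{x \<in> space N. {i \<in> {1..n}. f j x < f i x} = B} =
      {x \<in> space N. \<forall>i\<in>{1..n}. f j x < f i x \<longleftrightarrow> i \<in> B}"
    by (intro Collect_cong conj_cong refl) (simp only: set_eq_iff mem_Collect_eq, blast)
  also have "\<dots> \<in> sets N"
  proof (rule sets.sets_Collect_finite_All)
    fix i assume "i \<in> {1..n}"
    note [measurable] = f[OF this] f[OF j]
    show "{x \<in> space N. f j x < f i x \<longleftrightarrow> i \<in> B} \<in> sets N"
      by measurable
  qed simp
  finally show ?thesis .
next
  case False
  then have "{x \<in> space N. {i \<in> {1..n}. f j x < f i x} = B} = {}"
    by auto
  then show ?thesis
    by (simp only: sets.empty_sets)
qed

lemma borel_measurable_order_stat: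
  assumes M: "finite M" and k: "k \<in> {1..card M}"
    and T: "\<And>i. i \<in> M \<Longrightarrow> T i \<in> borel_measurable P"
  shows "order_stat T M k \<in> borel_measurable P"
  unfolding borel_measurable_iff_le
proof
  fix a
  have "order_stat T M k \<omega> \<le> a \<longleftrightarrow> k \<le> (\<Sum>i\<in>M. of_bool (T i \<omega> \<le> a))" for \<omega>
    using order_stat_iff[OF M k, of "\<lambda>t. t \<le> a" T \<omega>] M
    by (simp add: of_bool_def sum.If_cases Int_def)
  moreover have "{\<omega> \<in> space P. k \<le> (\<Sum>i\<in>M. of_bool (T i \<omega> \<le> a))} \<in> sets P"
  proof -
    have [measurable]: "(\<lambda>\<omega>. of_bool (T i \<omega> \<le> a) :: nat) \<in> measurable P (count_space UNIV)"
      if "i \<in> M" for i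
    proof -
      note [measurable] = T[OF that]
      show ?thesis
        unfolding of_bool_def by measurable
    qed
    show ?thesis
      by measurable
  qed
  ultimately show "{\<omega> \<in> space P. order_stat T M k \<omega> \<le> a} \<in> sets P"
    by simp
qed

lemma borel_measurable_system_lifetime:
  assumes "\<And>i. i \<in> {1..n} \<Longrightarrow> T i \<in> borel_measurable P"
  shows "system_lifetime n \<phi> T \<in> borel_measurable P"
proof -
  have "(\<lambda>\<omega>. Min ((\<lambda>i. T i \<omega>) ` A)) \<in> borel_measurable P" if "A \<subseteq> {1..n}" for A
    using that by (intro borel_measurable_Min assms) (auto intro: finite_subset)
  then show ?thesis
    unfolding system_lifetime_def by (intro borel_measurable_Max) auto
qed

lemma AE_inj_on:
  assumes "prob_space P" and T: "\<And>i. i \<in> {1..n} \<Longrightarrow> T i \<in> borel_measurable P"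
    and "no_ties P n T"
  shows "AE \<omega> in P. inj_on (\<lambda>i. T i \<omega>) {1..n}"
proof -
  interpret prob_space P by fact
  have "AE \<omega> in P. i \<noteq> j \<longrightarrow> T i \<omega> \<noteq> T j \<omega>" if ij: "i \<in> {1..n}" "j \<in> {1..n}" for i j
  proof (cases "i = j")
    case False
    note [measurable] = T[OF ij(1)] T[OF ij(2)]
    have "{\<omega> \<in> space P. T i \<omega> = T j \<omega>} \<in> events"
      by measurable
    then show ?thesis
      using assms(3) ij False prob_eq_0[of "{\<omega> \<in> space P. T i \<omega> = T j \<omega>}"]
      by (auto simp: no_ties_def elim!: eventually_mono)
  qed simp
  then have "AE \<omega> in P. \<forall>i\<in>{1..n}. \<forall>j\<in>{1..n}. i \<noteq> j \<longrightarrow> T i \<omega> \<noteq> T j \<omega>"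
    by (simp add: AE_ball_countable)
  then show ?thesis
    by eventually_elim (auto simp: inj_on_def)
qed

text \<open>Relabelling the components by \<open>\<pi>\<close> turns the event into one about \<open>T \<circ> \<pi>\<close>, which has the
  same joint distribution as \<open>T\<close>.\<close>

lemma prob_survivors_permute:
  assumes T: "\<And>i. i \<in> {1..n} \<Longrightarrow> T i \<in> borel_measurable P"
    and "exchangeable P n T" and \<pi>: "\<pi> permutes {1..n}"
    and j: "j \<in> {1..n}"
  shows "\<P>(\<omega> in P. {i \<in> {1..n}. T (\<pi> j) \<omega> < T i \<omega>} = \<pi> ` B) =
    \<P>(\<omega> in P. {i \<in> {1..n}. T j \<omega> < T i \<omega>} = B)"
proof -
  let ?N = "\<Pi>\<^sub>M i\<in>{1..n}. borel :: real measure"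
  let ?S = "{x \<in> space ?N. {i \<in> {1..n}. x j < x i} = B}"
  have S: "?S \<in> sets ?N"
    by (rule sets_survivors[OF _ j]) (rule measurable_component_singleton)
  have eq: "measure (distr P ?N (\<lambda>\<omega>. \<lambda>i\<in>{1..n}. T (\<rho> i) \<omega>)) ?S =
      \<P>(\<omega> in P. {i \<in> {1..n}. T (\<rho> j) \<omega> < T (\<rho> i) \<omega>} = B)" if "\<rho> permutes {1..n}" for \<rho>
  proof -
    have X: "(\<lambda>\<omega>. \<lambda>i\<in>{1..n}. T (\<rho> i) \<omega>) \<in> measurable P ?N"
      by (intro measurable_restrict T) (simp only: permutes_in_image[OF that])
    have "(\<lambda>i\<in>{1..n}. T (\<rho> i) \<omega>) \<in> ?S \<longleftrightarrow>
        {i \<in> {1..n}. T (\<rho> j) \<omega> < T (\<rho> i) \<omega>} = B" if "\<omega> \<in> space P" for \<omega>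
    proof -
      have "{i \<in> {1..n}. (\<lambda>i\<in>{1..n}. T (\<rho> i) \<omega>) j < (\<lambda>i\<in>{1..n}. T (\<rho> i) \<omega>) i} =
          {i \<in> {1..n}. T (\<rho> j) \<omega> < T (\<rho> i) \<omega>}"
        using j by auto
      then show ?thesis
        using measurable_space[OF X that] by (simp only: mem_Collect_eq simp_thms)
    qed
    then have "(\<lambda>\<omega>. \<lambda>i\<in>{1..n}. T (\<rho> i) \<omega>) -` ?S \<inter> space P =
        {\<omega> \<in> space P. {i \<in> {1..n}. T (\<rho> j) \<omega> < T (\<rho> i) \<omega>} = B}"
      by blast
    then show ?thesis
      unfolding measure_distr[OF X S] by (simp only:)
  qed
  have image: "{i \<in> {1..n}. T (\<pi> j) \<omega> < T i \<omega>} = \<pi> ` {i \<in> {1..n}. T (\<pi> j) \<omega> < T (\<pi> i) \<omega>}" for \<omega>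
  proof -
    have "{i \<in> {1..n}. T (\<pi> j) \<omega> < T i \<omega>} = {i \<in> \<pi> ` {1..n}. T (\<pi> j) \<omega> < T i \<omega>}"
      by (simp only: permutes_image[OF \<pi>])
    then show ?thesis
      by auto
  qed
  have "\<P>(\<omega> in P. {i \<in> {1..n}. T (\<pi> j) \<omega> < T i \<omega>} = \<pi> ` B) =
      \<P>(\<omega> in P. {i \<in> {1..n}. T (\<pi> j) \<omega> < T (\<pi> i) \<omega>} = B)"
    unfolding image by (simp only: inj_image_eq_iff[OF permutes_inj[OF \<pi>]])
  also have "\<dots> = \<P>(\<omega> in P. {i \<in> {1..n}. T j \<omega> < T i \<omega>} = B)"
    using eq[OF \<pi>] eq[OF permutes_id] assms(2) \<pi> by (simp add: exchangeable_def)
  finally show ?thesis .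
qed

lemma ex_permutes_image:
  assumes fin: "finite C" and "j \<in> C" "j' \<in> C" and "B \<subseteq> C - {j}" "B' \<subseteq> C - {j'}"
    and "card B = card B'"
  shows "\<exists>\<pi>. \<pi> permutes C \<and> \<pi> j = j' \<and> \<pi> ` B = B'"
proof -
  have finB: "finite B" "finite B'"
    using assms by (auto intro: finite_subset)
  obtain f where f: "bij_betw f B B'"
    using finite_same_card_bij[OF finB assms(6)] by blast
  have "card (C - insert j B) = card (C - insert j' B')"
    using assms finB by (subst (1 2) card_Diff_subset) (auto simp: card_insert_if subset_Diff_insert)
  then obtain g where g: "bij_betw g (C - insert j B) (C - insert j' B')"
    using finite_same_card_bij[OF finite_Diff[OF fin] finite_Diff[OF fin]] by blast
  define \<pi> where "\<pi> i = (if i \<in> B then f i else if i = j then j' else if i \<in> C then g i else i)" for i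
  have \<pi>: "bij_betw \<pi> B B'" "bij_betw \<pi> {j} {j'}" "bij_betw \<pi> (C - insert j B) (C - insert j' B')"
    using f g assms(4) by (auto simp: \<pi>_def bij_betw_def inj_on_def image_def)
  have "bij_betw \<pi> (B \<union> {j} \<union> (C - insert j B)) (B' \<union> {j'} \<union> (C - insert j' B'))"
    using assms(5) by (intro bij_betw_combine \<pi>) auto
  moreover have "B \<union> {j} \<union> (C - insert j B) = C" "B' \<union> {j'} \<union> (C - insert j' B') = C"
    using assms by auto
  ultimately have "\<pi> permutes C"
    using assms by (intro bij_imp_permutes) (auto simp: \<pi>_def)
  then show ?thesis
    using \<pi> by (auto simp: bij_betw_def)
qed

text \<open>By exchangeability the probability depends only on \<open>b = card B\<close>. Almost surely exactly one
  component is outlived by precisely \<open>b\<close> others, so the probabilities over all pairs with this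
  \<open>b\<close> add up to \<open>1\<close>, and there are \<open>n * ((n - 1) choose b)\<close> such pairs.\<close>

lemma prob_survivors:
  assumes "prob_space P" and T: "\<And>i. i \<in> {1..n} \<Longrightarrow> T i \<in> borel_measurable P"
    and "exchangeable P n T" and "no_ties P n T"
    and j: "j \<in> {1..n}" and B: "B \<subseteq> {1..n} - {j}"
  shows "\<P>(\<omega> in P. {i \<in> {1..n}. T j \<omega> < T i \<omega>} = B) =
    fact (card B) * fact (n - 1 - card B) / fact n"
proof -
  interpret prob_space P by fact
  let ?q = "\<lambda>(j, B). \<P>(\<omega> in P. {i \<in> {1..n}. T j \<omega> < T i \<omega>} = B)"
  define J where "J = (SIGMA j':{1..n}. {B'. B' \<subseteq> {1..n} - {j'} \<and> card B' = card B})"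
  have finB: "finite B"
    using B finite_subset by blast
  have n: "n \<ge> 1"
    using j by simp
  have le: "card B \<le> n - 1"
    using card_mono[OF _ B] j by simp
  have q: "?q p = ?q (j, B)" if "p \<in> J" for p
  proof -
    obtain j' B' where p: "p = (j', B')"
      by force
    then have j': "j' \<in> {1..n}" and B': "B' \<subseteq> {1..n} - {j'}" "card B' = card B"
      using that by (auto simp: J_def)
    obtain \<pi> where "\<pi> permutes {1..n}" "\<pi> j = j'" "\<pi> ` B = B'"
      using ex_permutes_image[of "{1..n}" j j' B B'] j j' B B' by auto
    then show ?thesis
      using prob_survivors_permute[OF T assms(3) _ j, of \<pi> B] p by simp
  qed
  have inj: "AE \<omega> in P. inj_on (\<lambda>i. T i \<omega>) {1..n}"
    by (rule AE_inj_on[OF assms(1) T assms(4)])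
  have finJ: "finite J"
    unfolding J_def by (rule finite_SigmaI) auto
  have "1 = \<P>(\<omega> in P. True)"
    by (simp add: prob_space)
  also have "\<dots> = (\<Sum>p\<in>J. \<P>(\<omega> in P. {i \<in> {1..n}. T (fst p) \<omega> < T i \<omega>} = snd p))"
  proof (rule prob_sum[OF finJ])
    show "{\<omega> \<in> space P. {i \<in> {1..n}. T (fst p) \<omega> < T i \<omega>} = snd p} \<in> events" if "p \<in> J" for p
      using that by (intro sets_survivors[OF T]) (auto simp: J_def)
    show "AE \<omega> in P. (\<forall>p\<in>J. {i \<in> {1..n}. T (fst p) \<omega> < T i \<omega>} = snd p \<longrightarrow> True) \<and>
        (True \<longrightarrow> (\<exists>!p\<in>J. {i \<in> {1..n}. T (fst p) \<omega> < T i \<omega>} = snd p))"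
      using inj
    proof eventually_elim
      case (elim \<omega>)
      let ?G = "\<lambda>j. {i \<in> {1..n}. T j \<omega> < T i \<omega>}"
      have "\<exists>!j'. j' \<in> {1..n} \<and> card (?G j') = card B"
        using ex1_rank[of "{1..n}" "n - card B" T \<omega>] elim le n by simp
      then obtain j0 where j0: "j0 \<in> {1..n}" "card (?G j0) = card B"
        and uniq: "\<And>j'. j' \<in> {1..n} \<Longrightarrow> card (?G j') = card B \<Longrightarrow> j' = j0"
        by blast
      have "\<exists>!p. p \<in> J \<and> ?G (fst p) = snd p"
      proof (rule ex1I[of _ "(j0, ?G j0)"])
        show "(j0, ?G j0) \<in> J \<and> ?G (fst (j0, ?G j0)) = snd (j0, ?G j0)"
          using j0 by (auto simp: J_def)
        fix p assume p: "p \<in> J \<and> ?G (fst p) = snd p"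
        then have "fst p = j0"
          by (intro uniq) (auto simp: J_def)
        then show "p = (j0, ?G j0)"
          using p by (simp add: prod_eq_iff)
      qed
      then show ?case
        by simp
    qed
  qed simp
  also have "\<dots> = (\<Sum>p\<in>J. ?q (j, B))"
    using q by (intro sum.cong) (auto simp: case_prod_unfold)
  also have "\<dots> = real (card J) * ?q (j, B)"
    by simp
  also have "card J = n * ((n - 1) choose card B)"
    unfolding J_def by (subst card_SigmaI) (auto simp: n_subsets)
  also have "real \<dots> = fact n / (fact (card B) * fact (n - 1 - card B))"
    using n by (simp only: of_nat_mult binomial_fact[OF le]) (simp add: fact_reduce[of n])
  finally show ?thesis
    by (simp add: field_simps)
qed

text \<open>The Beta integral at integers. It lets the probability in \<open>prob_survivors\<close> be written as an
  integral, as if the lifetimes were independent and uniformly distributed.\<close>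

lemma integral_power_Beta:
  "((\<lambda>t::real. t ^ a * (1 - t) ^ b) has_integral fact a * fact b / fact (a + b + 1)) {0..1}"
proof -
  have "((\<lambda>t::real. t powr (real (Suc a) - 1) * (1 - t) powr (real (Suc b) - 1)) has_integral
      Beta (real (Suc a)) (real (Suc b))) {0..1}"
    by (rule has_integral_Beta_real) auto
  moreover have "Beta (real (Suc a)) (real (Suc b)) = fact a * fact b / fact (a + b + 1)"
  proof -
    have "Beta (real (Suc a)) (real (Suc b)) = 
      Gamma (1 + real a) * Gamma (1 + real b) / Gamma (1 + real (a + b + 1))"
      by (simp add: Beta_def add_ac)
    then show ?thesis
      by (simp only: Gamma_fact)
  qed
  ultimately have "((\<lambda>t::real. t powr (real (Suc a) - 1) * (1 - t) powr (real (Suc b) - 1))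
      has_integral fact a * fact b / fact (a + b + 1)) {0..1}"
    by simp
  \<comment> \<open>At the end points the real power differs, since \<open>0 powr 0 = 0\<close> but \<open>0 ^ 0 = 1\<close>.\<close>
  then show ?thesis
    by (rule has_integral_spike_finite[of "{0, 1}", rotated 2]) (auto simp: powr_realpow)
qed

section \<open>The coefficients of the transformed derivative\<close>

lemma sum_Pow_split:
  assumes "finite D" and "j \<notin> D"
  shows "(\<Sum>A\<in>Pow (insert j D). f A) = (\<Sum>B\<in>Pow D. f (insert j B) + f B)"
proof -
  have "(\<Sum>A\<in>Pow (insert j D). f A) = (\<Sum>B\<in>Pow D. f B) + (\<Sum>A\<in>insert j ` Pow D. f A)"
    unfolding Pow_insert by (rule sum.union_disjoint) (use assms in auto)
  also have "(\<Sum>A\<in>insert j ` Pow D. f A) = (\<Sum>B\<in>Pow D. f (insert j B))"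
    by (rule sum.reindex_cong[of "insert j"]) (use assms(2) in \<open>auto simp: inj_on_def\<close>)
  finally show ?thesis
    by (simp add: sum.distrib add.commute)
qed

text \<open>The chain rule for the multilinear polynomial \<open>h\<close>. The partial derivative in direction \<open>j\<close>
  pairs the terms of \<open>B\<close> and \<open>insert j B\<close> and leaves the factor
  \<open>\<phi> (insert j B) - \<phi> B\<close>, which by monotonicity is \<open>1\<close> if \<open>j\<close> is pivotal at \<open>B\<close> and
  \<open>0\<close> otherwise.\<close>

lemma pderiv_reliability:
  fixes x :: "nat \<Rightarrow> 'b::idom poly"
  assumes "semicoherent n \<phi>" and M: "M \<subseteq> {1..n}"
    and x: "\<And>i. i \<in> {1..n} \<Longrightarrow> pderiv (x i) = of_bool (i \<in> M)"
  shows "pderiv (reliability n \<phi> x) =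
    (\<Sum>(j, B)\<in>pivots n \<phi> M. (\<Prod>i\<in>B. x i) * (\<Prod>i\<in>{1..n} - {j} - B. 1 - x i))"
proof -
  let ?y = "\<lambda>A i. if i \<in> A then x i else 1 - x i"
  have prod_y: "(\<Prod>i\<in>D. ?y A i) = (\<Prod>i\<in>A. x i) * (\<Prod>i\<in>D - A. 1 - x i)"
    if "A \<subseteq> D" "finite D" for A D
    using that prod.If_cases[of D "\<lambda>i. i \<in> A" x "\<lambda>i. 1 - x i"]
    by (simp add: Diff_eq Int_absorb1)
  have pderiv_sum: "pderiv (\<Sum>A\<in>S. f A) = (\<Sum>A\<in>S. pderiv (f A))"
    for S :: "nat set set" and f :: "nat set \<Rightarrow> 'b poly"
    using higher_pderiv_sum[of "Suc 0" f S] by simp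
  have "reliability n \<phi> x = (\<Sum>A\<in>Pow {1..n}. of_bool (\<phi> A) * (\<Prod>i\<in>{1..n}. ?y A i))"
    unfolding reliability_def by (intro sum.cong refl) (auto simp: prod_y mult.assoc)
  then have "pderiv (reliability n \<phi> x) =
      (\<Sum>A\<in>Pow {1..n}. of_bool (\<phi> A) * pderiv (\<Prod>i\<in>{1..n}. ?y A i))"
    by (auto simp: pderiv_sum intro!: sum.cong)
  also have "\<dots> = (\<Sum>A\<in>Pow {1..n}. of_bool (\<phi> A) *
      (\<Sum>j\<in>M. (\<Prod>i\<in>{1..n} - {j}. ?y A i) * (if j \<in> A then 1 else - 1)))"
  proof (intro sum.cong arg_cong2[where f = "(*)"] refl)
    fix A
    show "pderiv (\<Prod>i\<in>{1..n}. ?y A i) =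
        (\<Sum>j\<in>M. (\<Prod>i\<in>{1..n} - {j}. ?y A i) * (if j \<in> A then 1 else - 1))"
      unfolding pderiv_prod
      by (rule sum.mono_neutral_cong_right) (use M x in \<open>auto simp: pderiv_diff subset_iff\<close>)
  qed
  also have "\<dots> = (\<Sum>j\<in>M. \<Sum>A\<in>Pow {1..n}. of_bool (\<phi> A) *
      ((\<Prod>i\<in>{1..n} - {j}. ?y A i) * (if j \<in> A then 1 else - 1)))"
    unfolding sum_distrib_left by (rule sum.swap)
  also have "\<dots> = (\<Sum>j\<in>M. \<Sum>B | B \<in> Pow ({1..n} - {j}) \<and> \<phi> (insert j B) \<and> \<not> \<phi> B.
      (\<Prod>i\<in>B. x i) * (\<Prod>i\<in>{1..n} - {j} - B. 1 - x i))"
  proof (rule sum.cong[OF refl])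
    fix j assume "j \<in> M"
    let ?D = "{1..n} - {j}"
    have insert: "{1..n} = insert j ?D"
      using \<open>j \<in> M\<close> M by auto
    have "(\<Sum>A\<in>Pow {1..n}. of_bool (\<phi> A) * ((\<Prod>i\<in>?D. ?y A i) * (if j \<in> A then 1 else - 1))) =
        (\<Sum>B\<in>Pow ?D. of_bool (\<phi> (insert j B)) *
            ((\<Prod>i\<in>?D. ?y (insert j B) i) * (if j \<in> insert j B then 1 else - 1)) +
          of_bool (\<phi> B) * ((\<Prod>i\<in>?D. ?y B i) * (if j \<in> B then 1 else - 1)))"
      by (subst (1) insert, rule sum_Pow_split) auto
    also have "\<dots> = (\<Sum>B\<in>Pow ?D. if \<phi> (insert j B) \<and> \<not> \<phi> B
        then (\<Prod>i\<in>B. x i) * (\<Prod>i\<in>?D - B. 1 - x i) else 0)"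
    proof (rule sum.cong[OF refl])
      fix B assume B: "B \<in> Pow ?D"
      have "insert j B \<subseteq> {1..n}"
        using B insert by blast
      then have mono: "\<phi> B \<Longrightarrow> \<phi> (insert j B)"
        using semicoherent_mono[OF assms(1), of B "insert j B"] by blast
      have "(\<Prod>i\<in>?D. ?y (insert j B) i) = (\<Prod>i\<in>?D. ?y B i)"
        by (rule prod.cong) auto
      then show "of_bool (\<phi> (insert j B)) *
            ((\<Prod>i\<in>?D. ?y (insert j B) i) * (if j \<in> insert j B then 1 else - 1)) +
          of_bool (\<phi> B) * ((\<Prod>i\<in>?D. ?y B i) * (if j \<in> B then 1 else - 1)) =
          (if \<phi> (insert j B) \<and> \<not> \<phi> B
           then (\<Prod>i\<in>B. x i) * (\<Prod>i\<in>?D - B. 1 - x i) else 0)"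
        using B mono by (auto simp: prod_y)
    qed
    also have "\<dots> = (\<Sum>B | B \<in> Pow ?D \<and> \<phi> (insert j B) \<and> \<not> \<phi> B.
        (\<Prod>i\<in>B. x i) * (\<Prod>i\<in>?D - B. 1 - x i))"
      by (subst sum.inter_filter) auto
    finally show "(\<Sum>A\<in>Pow {1..n}. of_bool (\<phi> A) *
        ((\<Prod>i\<in>?D. ?y A i) * (if j \<in> A then 1 else - 1))) = \<dots>" .
  qed
  also have "\<dots> = (\<Sum>(j, B)\<in>pivots n \<phi> M. (\<Prod>i\<in>B. x i) * (\<Prod>i\<in>{1..n} - {j} - B. 1 - x i))"
    unfolding pivots_def using M by (subst sum.Sigma) (auto simp: finite_subset[of M "{1..n}"])
  finally show ?thesis .
qed

lemma coeff_reflected: "coeff (reflected p f) i = (if i \<le> p then coeff f (p - i) else 0)"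
proof -
  have "coeff (reflected p f) i = (\<Sum>j\<le>p. if j = p - i \<and> i \<le> p then coeff f j else 0)"
    unfolding reflected_def coeff_sum by (intro sum.cong) auto
  also have "\<dots> = (if i \<le> p then coeff f (p - i) else 0)"
    by auto
  finally show ?thesis .
qed

lemma reflected_sum: "reflected p (\<Sum>a\<in>S. f a) = (\<Sum>a\<in>S. reflected p (f a))"
  by (rule poly_eqI) (simp add: coeff_reflected coeff_sum)

lemma reflected_smult: "reflected p (smult c f) = smult c (reflected p f)"
  by (rule poly_eqI) (simp add: coeff_reflected)

lemma reflected_degree: "reflected (degree f) f = reflect_poly f"
  by (rule poly_eqI) (simp add: coeff_reflected coeff_reflect_poly)

text \<open>This is what the reflection and the shift are for: \<open>x ^ b * (1 - x) ^ c\<close> is reflected to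
  \<open>(x - 1) ^ c\<close>, which the shift makes a single monomial. The coefficients of the transformed
  polynomial therefore separate the Bernstein polynomials.\<close>

lemma shifted_reflected_Bernstein:
  "pcompose (reflected (b + c) ([:0, 1:] ^ b * (1 - [:0, 1:]) ^ c)) [:1, 1:] =
    (monom 1 c :: 'b::idom poly)"
proof -
  have one_minus: "1 - [:0, 1:] = ([:1, - 1:] :: 'b poly)"
    by (simp add: one_pCons)
  let ?f = "[:0, 1:] ^ b * [:1, - 1:] ^ c :: 'b poly"
  have "degree ?f = b + c"
    by (simp add: degree_mult_eq degree_power_eq)
  then have "reflected (b + c) ?f = reflect_poly ?f"
    using reflected_degree[of ?f] by simp
  also have "\<dots> = [:- 1, 1:] ^ c"
  proof -
    have "reflect_poly [:0, 1:] = (1 :: 'b poly)"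
      by (simp add: reflect_poly_def one_pCons)
    moreover have "reflect_poly [:1, - 1:] = ([:- 1, 1:] :: 'b poly)"
      by (simp add: reflect_poly_pCons)
    ultimately show ?thesis
      by (simp add: reflect_poly_mult reflect_poly_power)
  qed
  finally have "reflected (b + c) ?f = [:- 1, 1:] ^ c" .
  moreover have "pcompose ([:- 1, 1:] ^ c) [:1, 1:] = ([:0, 1:] ^ c :: 'b poly)"
    by (induction c) (simp_all add: pcompose_mult pcompose_pCons pcompose_1 del: mult_pCons_left)
  ultimately show ?thesis
    unfolding one_minus by (simp add: monom_altdef)
qed

text \<open>After the substitution, the term of \<open>(j, B)\<close> in \<open>pderiv_reliability\<close> is a polynomial in \<open>z\<close>
  times the Bernstein polynomial in \<open>x\<close> with exponents \<open>card (B \<inter> M)\<close> and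
  \<open>card M - 1 - card (B \<inter> M)\<close>. It contributes to the coefficient of \<open>x ^ (k - 1)\<close> exactly if
  the second exponent is \<open>k - 1\<close>.\<close>

lemma signature_coeff_eq:
  assumes "semicoherent n \<phi>" and M: "M \<subseteq> {1..n}" and k: "k \<in> {1..card M}"
  shows "signature_coeff n \<phi> M (k - 1) =
    (\<Sum>(j, B)\<in>{(j, B) \<in> pivots n \<phi> M. card (B \<inter> M) = card M - k}.
      [:0, 1:] ^ card (B - M) * [:1, - 1:] ^ card ({1..n} - {j} - B - M))"
proof -
  let ?x = "\<lambda>i. if i \<in> M then [:0, 1:] else [:[:0, 1:]:] :: real poly poly"
  let ?w = "\<lambda>j B. [:0, 1:] ^ card (B - M) * [:1, - 1:] ^ card ({1..n} - {j} - B - M) :: real poly"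
  have finM: "finite M"
    using M finite_subset by blast
  have split: "(\<Prod>i\<in>A. if i \<in> M then p else q) = p ^ card (A \<inter> M) * q ^ card (A - M)"
    if "finite A" for A and p q :: "real poly poly"
    using that by (simp add: prod.If_cases Diff_eq)
  have const: "[:p:] ^ e = [:p ^ e:]" for p :: "real poly" and e
    by (induction e) (auto simp: one_pCons)
  have "reliability_xz n \<phi> M = reliability n \<phi> ?x"
    by (simp add: reliability_xz_def)
  also have "pderiv \<dots> = (\<Sum>(j, B)\<in>pivots n \<phi> M.
      (\<Prod>i\<in>B. ?x i) * (\<Prod>i\<in>{1..n} - {j} - B. 1 - ?x i))"
    by (rule pderiv_reliability[OF assms(1) M]) (auto simp: pderiv_pCons)
  also have "\<dots> = (\<Sum>(j, B)\<in>pivots n \<phi> M. smult (?w j B)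
      ([:0, 1:] ^ card (B \<inter> M) * (1 - [:0, 1:]) ^ (card M - 1 - card (B \<inter> M))))"
  proof (intro sum.cong refl, clarify)
    fix j B assume "(j, B) \<in> pivots n \<phi> M"
    then have j: "j \<in> M" and B: "B \<subseteq> {1..n} - {j}"
      by (auto simp: pivots_def)
    have fin: "finite B"
      using B finite_subset by blast
    have "({1..n} - {j} - B) \<inter> M = M - {j} - B \<inter> M"
      using M by auto
    also have "card \<dots> = card M - 1 - card (B \<inter> M)"
      using finM j B by (subst card_Diff_subset) auto
    finally have card: "card (({1..n} - {j} - B) \<inter> M) = card M - 1 - card (B \<inter> M)" .
    have "(\<Prod>i\<in>{1..n} - {j} - B. 1 - ?x i) =
        (\<Prod>i\<in>{1..n} - {j} - B. if i \<in> M then 1 - [:0, 1:] else [:[:1, - 1:]:])"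
      by (intro prod.cong) (auto simp: one_pCons)
    then have "(\<Prod>i\<in>{1..n} - {j} - B. 1 - ?x i) =
        (1 - [:0, 1:]) ^ (card M - 1 - card (B \<inter> M)) *
        [:[:1, - 1:] ^ card ({1..n} - {j} - B - M):]"
      by (simp only: split[OF finite_Diff[OF finite_Diff[OF finite_atLeastAtMost]]] card const)
    moreover have "(\<Prod>i\<in>B. ?x i) = [:0, 1:] ^ card (B \<inter> M) * [:[:0, 1:] ^ card (B - M):]"
      by (simp only: split[OF fin] const)
    ultimately show "(\<Prod>i\<in>B. ?x i) * (\<Prod>i\<in>{1..n} - {j} - B. 1 - ?x i) = smult (?w j B)
        ([:0, 1:] ^ card (B \<inter> M) * (1 - [:0, 1:]) ^ (card M - 1 - card (B \<inter> M)))"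
      by (simp add: mult_ac)
  qed
  finally have "pcompose (reflected (card M - 1) (pderiv (reliability_xz n \<phi> M))) [:1, 1:] =
      (\<Sum>(j, B)\<in>pivots n \<phi> M. smult (?w j B) (pcompose (reflected (card M - 1)
        ([:0, 1:] ^ card (B \<inter> M) * (1 - [:0, 1:]) ^ (card M - 1 - card (B \<inter> M)))) [:1, 1:]))"
    by (simp add: reflected_sum reflected_smult pcompose_sum pcompose_smult case_prod_unfold)
  also have "\<dots> = (\<Sum>(j, B)\<in>pivots n \<phi> M.
      smult (?w j B) (monom 1 (card M - 1 - card (B \<inter> M))))"
  proof (intro sum.cong refl, clarify)
    fix j B assume "(j, B) \<in> pivots n \<phi> M"
    then have j: "j \<in> M" and "B \<inter> M \<subseteq> M - {j}"
      by (auto simp: pivots_def)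
    then have "card (B \<inter> M) \<le> card M - 1"
      using finM card_mono[of "M - {j}" "B \<inter> M"] by simp
    then have "card (B \<inter> M) + (card M - 1 - card (B \<inter> M)) = card M - 1"
      by simp
    then show "smult (?w j B) (pcompose (reflected (card M - 1)
        ([:0, 1:] ^ card (B \<inter> M) * (1 - [:0, 1:]) ^ (card M - 1 - card (B \<inter> M)))) [:1, 1:]) =
        smult (?w j B) (monom 1 (card M - 1 - card (B \<inter> M)))"
      using shifted_reflected_Bernstein[of "card (B \<inter> M)" "card M - 1 - card (B \<inter> M)",
          where 'b = "real poly"] by (simp only:)
  qed
  finally have "signature_coeff n \<phi> M (k - 1) =
      (\<Sum>(j, B)\<in>pivots n \<phi> M. coeff (smult (?w j B) (monom 1 (card M - 1 - card (B \<inter> M)))) (k - 1))"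
    by (simp add: signature_coeff_def coeff_sum case_prod_unfold)
  also have "\<dots> = (\<Sum>(j, B)\<in>{(j, B) \<in> pivots n \<phi> M. card (B \<inter> M) = card M - k}. ?w j B)"
  proof (rule sum.mono_neutral_cong_right[OF finite_pivots[OF M]])
    have coeff: "coeff (smult (?w j B) (monom 1 (card M - 1 - card (B \<inter> M)))) (k - 1) =
        (if card (B \<inter> M) = card M - k then ?w j B else 0)" if "(j, B) \<in> pivots n \<phi> M" for j B
    proof -
      have "j \<in> M" and "B \<inter> M \<subseteq> M - {j}"
        using that by (auto simp: pivots_def)
      then have "card (B \<inter> M) \<le> card M - 1"
        using finM card_mono[of "M - {j}" "B \<inter> M"] by simp
      then have "card M - 1 - card (B \<inter> M) = k - 1 \<longleftrightarrow> card (B \<inter> M) = card M - k"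
        using k by auto
      then show ?thesis
        by simp
    qed
    show "\<forall>p\<in>pivots n \<phi> M - {(j, B) \<in> pivots n \<phi> M. card (B \<inter> M) = card M - k}.
        (case p of (j, B) \<Rightarrow>
          coeff (smult (?w j B) (monom 1 (card M - 1 - card (B \<inter> M)))) (k - 1)) = 0"
    proof
      fix p assume p: "p \<in> pivots n \<phi> M - {(j, B) \<in> pivots n \<phi> M. card (B \<inter> M) = card M - k}"
      obtain j B where jB: "p = (j, B)"
        by force
      then have "(j, B) \<in> pivots n \<phi> M" "card (B \<inter> M) \<noteq> card M - k"
        using p by auto
      then show "(case p of (j, B) \<Rightarrow>
          coeff (smult (?w j B) (monom 1 (card M - 1 - card (B \<inter> M)))) (k - 1)) = 0"
        unfolding jB prod.case coeff[OF \<open>(j, B) \<in> pivots n \<phi> M\<close>] by simp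
    qed
    show "(case p of (j, B) \<Rightarrow>
          coeff (smult (?w j B) (monom 1 (card M - 1 - card (B \<inter> M)))) (k - 1)) =
        (case p of (j, B) \<Rightarrow> ?w j B)"
      if p: "p \<in> {(j, B) \<in> pivots n \<phi> M. card (B \<inter> M) = card M - k}" for p
    proof -
      obtain j B where jB: "p = (j, B)"
        by force
      then have "(j, B) \<in> pivots n \<phi> M" "card (B \<inter> M) = card M - k"
        using p by auto
      then show ?thesis
        unfolding jB prod.case coeff[OF \<open>(j, B) \<in> pivots n \<phi> M\<close>] by simp
    qed
  qed auto
  finally show ?thesis .
qed

section \<open>The signature as an integral\<close>

theorem mainTheorem1:
  fixes P :: "'a measure" and n :: nat and \<phi> :: "nat set \<Rightarrow> bool"
    and T :: "nat \<Rightarrow> 'a \<Rightarrow> real" and M :: "nat set" and k :: nat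
  assumes "prob_space P"
    and "semicoherent n \<phi>"
    and "\<And>i. i \<in> {1..n} \<Longrightarrow> T i \<in> borel_measurable P"
    and "\<And>i \<omega>. i \<in> {1..n} \<Longrightarrow> \<omega> \<in> space P \<Longrightarrow> 0 \<le> T i \<omega>"
    and "exchangeable P n T"
    and "no_ties P n T"
    and "M \<subseteq> {1..n}" and "M \<noteq> {}"
    and "k \<in> {1..card M}"
  shows "M_signature P n \<phi> T M k =
    integral {0..1} (\<lambda>t::real. t ^ (card M - k) * (1 - t) ^ (k - 1) *
                               poly (signature_coeff n \<phi> M (k - 1)) t)"
proof -
  interpret prob_space P by fact
  note T = assms(3) and M = assms(7) and k = assms(9)
  define I where "I = {(j, B) \<in> pivots n \<phi> M. card (B \<inter> M) = card M - k}"
  have finM: "finite M"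
    using M by (rule finite_subset) simp
  have finI: "finite I"
    using finite_pivots[OF M] by (rule finite_subset[rotated]) (auto simp: I_def)
  have I: "j \<in> M" "j \<in> {1..n}" "B \<subseteq> {1..n} - {j}" "card (B \<inter> M) = card M - k"
    if "(j, B) \<in> I" for j B
    using that M by (auto simp: I_def pivots_def)
  have [measurable]: "system_lifetime n \<phi> T \<in> borel_measurable P"
    by (rule borel_measurable_system_lifetime) (rule T)
  have [measurable]: "order_stat T M k \<in> borel_measurable P"
    by (rule borel_measurable_order_stat[OF finM k]) (use T M in blast)
  have "M_signature P n \<phi> T M k =
      (\<Sum>p\<in>I. \<P>(\<omega> in P. case p of (j, B) \<Rightarrow> {i \<in> {1..n}. T j \<omega> < T i \<omega>} = B))"
    unfolding M_signature_def
  proof (rule prob_sum[OF finI])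
    fix p assume "p \<in> I"
    moreover obtain j B where p: "p = (j, B)"
      by force
    ultimately have "j \<in> {1..n}"
      using I by blast
    then show "{\<omega> \<in> space P. case p of (j, B) \<Rightarrow> {i \<in> {1..n}. T j \<omega> < T i \<omega>} = B} \<in> events"
      unfolding p prod.case by (intro sets_survivors T)
  next
    have "AE \<omega> in P. inj_on (\<lambda>i. T i \<omega>) {1..n}"
      by (rule AE_inj_on[OF assms(1) T assms(6)])
    then show "AE \<omega> in P.
        (\<forall>p\<in>I. (case p of (j, B) \<Rightarrow> {i \<in> {1..n}. T j \<omega> < T i \<omega>} = B) \<longrightarrow>
          system_lifetime n \<phi> T \<omega> = order_stat T M k \<omega>) \<and>
        (system_lifetime n \<phi> T \<omega> = order_stat T M k \<omega> \<longrightarrow>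
          (\<exists>!p\<in>I. case p of (j, B) \<Rightarrow> {i \<in> {1..n}. T j \<omega> < T i \<omega>} = B))"
    proof eventually_elim
      case (elim \<omega>)
      show ?case
        using lifetime_eq_order_stat_iff[of n \<phi> T \<omega> M k, OF assms(2) elim M k]
        unfolding I_def by simp
    qed
  qed measurable
  also have "\<dots> = (\<Sum>(j, B)\<in>I. fact (card B) * fact (n - 1 - card B) / fact n)"
  proof (intro sum.cong refl, clarify)
    fix j B assume "(j, B) \<in> I"
    note I = I(2,3)[OF this]
    show "\<P>(\<omega> in P. {i \<in> {1..n}. T j \<omega> < T i \<omega>} = B) =
        fact (card B) * fact (n - 1 - card B) / fact n"
      by (rule prob_survivors[OF assms(1) T assms(5,6) I])
  qed
  also have "\<dots> = integral {0..1} (\<lambda>t. \<Sum>(j, B)\<in>I. t ^ card B * (1 - t) ^ (n - 1 - card B))"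
  proof -
    have "((\<lambda>t. \<Sum>(j, B)\<in>I. t ^ card B * (1 - t) ^ (n - 1 - card B)) has_integral
        (\<Sum>(j, B)\<in>I. fact (card B) * fact (n - 1 - card B) / fact n)) {0..1::real}"
      unfolding case_prod_unfold
    proof (rule has_integral_sum[OF finI])
      fix p assume "p \<in> I"
      then have "card (snd p) \<le> n - 1" "fst p \<in> {1..n}"
        using I[of "fst p" "snd p"] card_mono[of "{1..n} - {fst p}" "snd p"] by auto
      then have "card (snd p) + (n - 1 - card (snd p)) + 1 = n"
        by auto
      then show "((\<lambda>t. t ^ card (snd p) * (1 - t) ^ (n - 1 - card (snd p))) has_integral
          fact (card (snd p)) * fact (n - 1 - card (snd p)) / fact n) {0..1::real}"
        using integral_power_Beta[of "card (snd p)" "n - 1 - card (snd p)"] by (simp only:)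
    qed
    then show ?thesis
      by (rule integral_unique[symmetric])
  qed
  also have "\<dots> = integral {0..1} (\<lambda>t. t ^ (card M - k) * (1 - t) ^ (k - 1) *
      poly (signature_coeff n \<phi> M (k - 1)) t)"
  proof (intro arg_cong[where f = "integral {0..1}"] ext)
    fix t :: real
    \<comment> \<open>Of the components other than \<open>j\<close>, those in \<open>M\<close> account for the factors that do not
      depend on \<open>(j, B)\<close>, the others for the term of \<open>(j, B)\<close> in \<open>signature_coeff_eq\<close>.\<close>
    have "t ^ card B * (1 - t) ^ (n - 1 - card B) = t ^ (card M - k) * (1 - t) ^ (k - 1) *
        (t ^ card (B - M) * (1 - t) ^ card ({1..n} - {j} - B - M))"
      if "(j, B) \<in> I" for j B
    proof -
      note I = I[OF that]
      have finB: "finite B"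
        using I(3) by (rule finite_subset) simp
      have b: "card B = card M - k + card (B - M)"
        using card_Int_Diff[OF finB, of M] I(4) by simp
      have "{1..n} - {j} - B - M = ({1..n} - M) - (B - M)"
        using I(1) by auto
      also have "card \<dots> = card ({1..n} - M) - card (B - M)"
        by (rule card_Diff_subset) (use finB I(3) in auto)
      also have "card ({1..n} - M) = n - card M"
        using finM M by (simp add: card_Diff_subset)
      finally have c: "card ({1..n} - {j} - B - M) = n - card M - card (B - M)" .
      have "card (B - M) \<le> card ({1..n} - M)"
        by (rule card_mono) (use I(3) in auto)
      then have "n - 1 - card B = (k - 1) + card ({1..n} - {j} - B - M)"
        using b c k finM M card_mono[OF _ M] by (simp add: card_Diff_subset)
      then show ?thesis
        unfolding b by (simp only: power_add mult_ac)
    qed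
    then have "(\<Sum>(j, B)\<in>I. t ^ card B * (1 - t) ^ (n - 1 - card B)) =
        (\<Sum>(j, B)\<in>I. t ^ (card M - k) * (1 - t) ^ (k - 1) *
          (t ^ card (B - M) * (1 - t) ^ card ({1..n} - {j} - B - M)))"
      by (intro sum.cong) auto
    also have "\<dots> = t ^ (card M - k) * (1 - t) ^ (k - 1) *
        poly (signature_coeff n \<phi> M (k - 1)) t"
      unfolding signature_coeff_eq[OF assms(2) M k, folded I_def]
      by (simp add: poly_sum case_prod_unfold sum_distrib_left)
    finally show "(\<Sum>(j, B)\<in>I. t ^ card B * (1 - t) ^ (n - 1 - card B)) = \<dots>" .
  qed
  finally show ?thesis .
qed

end
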